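(* Let $\Omega=\{A\in\mathbb{R}^{m\times m}:A=A^{\top}\}$ be the set of real symmetric matrices, let $\mathcal{P}=\{P\in\mathbb{R}^{m\times m}:P^\top=P^{-1}\}$ be the set of orthogonal matrices, let $s(A,B,P)=\|AP-PB\|$ for all $A,B\in\Omega$, $P\in\mathcal{P}$, where $\|\cdot\|$ is an orthogonally invariant matrix norm, and let $d(A,B)=\min_{P\in\mathcal{P}} s(A,B,P)$. Then the Fermat distance function $d_F$ induced by $d$, and the $\mathcal{G}$-align distance function $d_\mathcal{G}$ induced by $s$, are pseudo $n$-metrics.
   Context: For $A_1,\dots,A_n\in\Omega$, write $A_{1:n}=(A_1,\dots,A_n)$, and let $A^i_{1:n,n+1}$ denote the sequence $A_{1:n}$ with $A_i$ replaced by $A_{n+1}$. A map $d:\Omega^n\to\mathbb{R}$ is a pseudo $n$-metric if for all $A_1,\dots,A_{n+1}\in\Omega$: $d(A_{1:n})\ge 0$; $d(A,\dots,A)=0$; $d(A_{1:n})=d(A_{\sigma(1:n)})$ for every permutation $\sigma$ of the indices; and $d(A_{1:n})\le\sum_{i=1}^n d(A^i_{1:n,n+1})$. The Fermat distance function induced by $d:\Omega^2\to\mathbb{R}$ is $d_F(A_{1:n})=\min_{B\in\Omega}\sum_{i=1}^n d(A_i,B)$. The $\mathcal{G}$-align distance function induced by $s:\Omega^2\times\mathcal{P}\to\mathbb{R}$ is $d_\mathcal{G}(A_{1:n})=\min_{P\in S}\frac12\sum_{i,j\in[n]} s(A_i,A_j,P_{i,j})$, where $S=\{\{P_{i,j}\}_{i,j\in[n]}: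 P_{i,j}\in\mathcal{P}\ \forall i,j;\ P_{i,k}P_{k,j}=P_{i,j}\ \forall i,j,k;\ P_{i,i}=I\ \forall i\}$. A matrix norm is orthogonally invariant if $\|PM\|=\|MP\|=\|M\|$ for every orthogonal $P$. *)

theory Defs
  imports "HOL-Analysis.Analysis" "HOL-Combinatorics.Permutations"
begin

text \<open>Sequences A_{1:n} are represented as lists of length n (0-based indices).
  The sequence with A_i replaced by A_{n+1} = a is the list update xs[i := a].\<close>

definition pseudo_n_metric :: "'a set \<Rightarrow> nat \<Rightarrow> ('a list \<Rightarrow> real) \<Rightarrow> bool" where
  "pseudo_n_metric \<Omega> n d \<longleftrightarrow>
     (\<forall>xs. set xs \<subseteq> \<Omega> \<and> length xs = n \<longrightarrow> d xs \<ge> 0) \<and>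
     (\<forall>a\<in>\<Omega>. d (replicate n a) = 0) \<and>
     (\<forall>xs \<sigma>. set xs \<subseteq> \<Omega> \<and> length xs = n \<and> \<sigma> permutes {..<n} \<longrightarrow>
          d (map (\<lambda>i. xs ! \<sigma> i) [0..<n]) = d xs) \<and>
     (\<forall>xs a. set xs \<subseteq> \<Omega> \<and> length xs = n \<and> a \<in> \<Omega> \<longrightarrow>
          d xs \<le> (\<Sum>i<n. d (xs[i := a])))"

text \<open>Fermat distance induced by d on \<Omega>: min over B in \<Omega> of sum_i d(A_i, B)
  (written as infimum; the minimum is attained in the situation of the theorem).\<close>
definition fermat_dist :: "'a set \<Rightarrow> ('a \<Rightarrow> 'a \<Rightarrow> real) \<Rightarrow> 'a list \<Rightarrow> real" where
  "fermat_dist \<Omega> d xs = (INF B\<in>\<Omega>. (\<Sum>i<length xs. d (xs ! i) B))"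

text \<open>Consistent families {P_ij}_{i,j in [n]} with values in \<P>.\<close>
definition align_families :: "'p set \<Rightarrow> ('p \<Rightarrow> 'p \<Rightarrow> 'p) \<Rightarrow> 'p \<Rightarrow> nat \<Rightarrow> (nat \<Rightarrow> nat \<Rightarrow> 'p) set" where
  "align_families \<P> mul I n = {P. (\<forall>i<n. \<forall>j<n. P i j \<in> \<P>) \<and>
      (\<forall>i<n. \<forall>j<n. \<forall>k<n. mul (P i k) (P k j) = P i j) \<and> (\<forall>i<n. P i i = I)}"

text \<open>G-align distance induced by s (matrix version: product **, identity mat 1).\<close>
definition galign_dist :: "('a \<Rightarrow> 'a \<Rightarrow> real^'m^'m \<Rightarrow> real) \<Rightarrow> (real^'m^'m) set \<Rightarrow> 'a list \<Rightarrow> real" where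
  "galign_dist s \<P> xs = (INF P\<in>align_families \<P> (**) (mat 1) (length xs).
      (1/2) * (\<Sum>i<length xs. \<Sum>j<length xs. s (xs ! i) (xs ! j) (P i j)))"

definition sym_matrices :: "(real^'m^'m) set" where
  "sym_matrices = {A. transpose A = A}"

definition orth_matrices :: "(real^'m^'m) set" where
  "orth_matrices = {P. orthogonal_matrix P}"

text \<open>Orthogonally invariant matrix norm (norm axioms plus invariance).\<close>
definition orth_inv_matrix_norm :: "(real^'m^'m \<Rightarrow> real) \<Rightarrow> bool" where
  "orth_inv_matrix_norm N \<longleftrightarrow>
     (\<forall>M. N M \<ge> 0) \<and> (\<forall>M. N M = 0 \<longleftrightarrow> M = 0) \<and>
     (\<forall>c M. N (c *\<^sub>R M) = \<bar>c\<bar> * N M) \<and>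
     (\<forall>M M'. N (M + M') \<le> N M + N M') \<and>
     (\<forall>P M. orthogonal_matrix P \<longrightarrow> N (P ** M) = N M \<and> N (M ** P) = N M)"

end

theory Submission
  imports Defs
begin

text \<open>The orbit distance \<open>d(A, B) = min\<^sub>P \<parallel>P\<^sup>T A P - B\<parallel>\<close> is a pseudometric: it is symmetric
  because \<open>P \<mapsto> P\<^sup>T\<close> preserves orthogonality, and it satisfies the triangle inequality because
  orthogonal matrices compose. A consistent family of orthogonal matrices is exactly one of the
  form \<open>P\<^sub>i\<^sub>j = R\<^sub>i R\<^sub>j\<^sup>T\<close> with \<open>R\<^sub>i\<close> orthogonal, so \<open>d\<^sub>\<G>\<close> is half the least sum of the pairwise
  distances \<open>\<parallel>R\<^sub>i\<^sup>T A\<^sub>i R\<^sub>i - R\<^sub>j\<^sup>T A\<^sub>j R\<^sub>j\<parallel>\<close>, i.e. a Fermat-like problem on orbits.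
  Both \<open>d\<^sub>F\<close> and \<open>d\<^sub>\<G>\<close> dominate every \<open>d(A\<^sub>i, A\<^sub>j)\<close>, and replacing \<open>A\<^sub>1\<close> by \<open>A\<^sub>n\<^sub>+\<^sub>1\<close> changes them by
  at most \<open>(n - 1) d(A\<^sub>1, A\<^sub>n\<^sub>+\<^sub>1)\<close>. Each of the other \<open>n - 1\<close> modified sequences contains both
  \<open>A\<^sub>1\<close> and \<open>A\<^sub>n\<^sub>+\<^sub>1\<close>, which pays for this change and yields the \<open>n\<close>-triangle inequality.\<close>

lemma le_mult_cINF:
  fixes f :: "'a \<Rightarrow> real"
  assumes "A \<noteq> {}" "0 \<le> c" "\<And>x. x \<in> A \<Longrightarrow> a \<le> c * f x"
  shows "a \<le> c * (INF x\<in>A. f x)"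
proof (cases "c = 0")
  case True
  then show ?thesis using assms(1,3) by auto
next
  case False
  then have "a / c \<le> (INF x\<in>A. f x)"
    using assms by (intro cINF_greatest) (auto simp: divide_le_eq mult.commute)
  then show ?thesis using False assms(2) by (simp add: divide_le_eq mult.commute)
qed

lemma pseudo_n_metric_if_update_bound:
  fixes D :: "'a list \<Rightarrow> real" and d :: "'a \<Rightarrow> 'a \<Rightarrow> real"
  assumes nonneg: "\<And>xs. set xs \<subseteq> S \<Longrightarrow> 0 \<le> D xs"
    and replicate: "\<And>a m. a \<in> S \<Longrightarrow> D (replicate m a) = 0"
    and permute: "\<And>xs \<sigma>. set xs \<subseteq> S \<Longrightarrow> \<sigma> permutes {..<length xs} \<Longrightarrow> D (permute_list \<sigma> xs) = D xs"
    and update: "\<And>xs a. set xs \<subseteq> S \<Longrightarrow> a \<in> S \<Longrightarrow> 2 \<le> length xs \<Longrightarrow>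
        D xs \<le> D (xs[0 := a]) + real (length xs - 1) * d (xs ! 0) a"
    and lower: "\<And>xs i j. set xs \<subseteq> S \<Longrightarrow> i < length xs \<Longrightarrow> j < length xs \<Longrightarrow> d (xs ! i) (xs ! j) \<le> D xs"
  shows "pseudo_n_metric S n D"
proof -
  have triangle: "D xs \<le> (\<Sum>i<n. D (xs[i := a]))"
    if xs: "set xs \<subseteq> S" "length xs = n" and a: "a \<in> S" for xs a
  proof (cases "n \<le> 1")
    case True
    then obtain x where "x \<in> S" "xs = replicate n x"
      using xs a by (cases xs) auto
    then have "D xs = 0" by (simp add: replicate)
    also have "0 \<le> (\<Sum>i<n. D (xs[i := a]))"
      using xs a by (intro sum_nonneg nonneg) (auto dest: subsetD[OF set_update_subset_insert])
    finally show ?thesis .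
  next
    case False
    then obtain m where n: "n = Suc m" by (cases n) auto
    have "real m * d (xs ! 0) a = (\<Sum>i<m. d (xs[Suc i := a] ! 0) (xs[Suc i := a] ! Suc i))"
      using xs n by simp
    also have "\<dots> \<le> (\<Sum>i<m. D (xs[Suc i := a]))"
      using xs a n by (intro sum_mono lower) (auto dest: subsetD[OF set_update_subset_insert])
    finally have "D xs \<le> D (xs[0 := a]) + (\<Sum>i<m. D (xs[Suc i := a]))"
      using update[OF xs(1) a] xs False n by simp
    then show ?thesis unfolding n sum.lessThan_Suc_shift .
  qed
  show ?thesis
    unfolding pseudo_n_metric_def using nonneg replicate permute triangle
    by (auto simp: permute_list_def)
qed

locale pseudometric_on =
  fixes S :: "'a set" and d :: "'a \<Rightarrow> 'a \<Rightarrow> real"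
  assumes self_zero: "x \<in> S \<Longrightarrow> d x x = 0"
    and commute: "x \<in> S \<Longrightarrow> y \<in> S \<Longrightarrow> d x y = d y x"
    and triangle: "x \<in> S \<Longrightarrow> y \<in> S \<Longrightarrow> z \<in> S \<Longrightarrow> d x z \<le> d x y + d y z"
begin

lemma nonneg: "x \<in> S \<Longrightarrow> y \<in> S \<Longrightarrow> 0 \<le> d x y"
  using triangle[of x y x] self_zero[of x] commute[of x y] by simp

lemma subset: "T \<subseteq> S \<Longrightarrow> pseudometric_on T d"
  by unfold_locales (auto intro: self_zero commute triangle)

lemma sum_pairwise_update_le:
  assumes k: "k < n" and g: "\<And>i. i < n \<Longrightarrow> g i \<in> S" and y: "y \<in> S"
  shows "(\<Sum>i<n. \<Sum>j<n. d ((g(k := y)) i) ((g(k := y)) j))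
    \<le> (\<Sum>i<n. \<Sum>j<n. d (g i) (g j)) + 2 * real (n - 1) * d y (g k)"
proof -
  define c where "c l = (if l = k then 0 else d y (g k))" for l
  have "(\<Sum>l<n. c l) = (\<Sum>l<n. d y (g k) - (if l = k then d y (g k) else 0))"
    by (intro sum.cong) (auto simp: c_def)
  also have "\<dots> = real (n - 1) * d y (g k)"
    using k by (simp add: sum_subtractf of_nat_diff algebra_simps)
  finally have c_sum: "(\<Sum>l<n. c l) = real (n - 1) * d y (g k)" .
  have c_sum': "(\<Sum>i<n. \<Sum>j<n. if i = k then c j else 0) = real (n - 1) * d y (g k)"
    using k c_sum by (subst sum.swap) simp
  have "d ((g(k := y)) i) ((g(k := y)) j)
      \<le> d (g i) (g j) + (if i = k then c j else 0) + (if j = k then c i else 0)"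
    if "i < n" "j < n" for i j
    using that k g y self_zero triangle[of y "g k" "g j"] triangle[of "g i" "g k" y] commute[of y "g k"]
    by (auto simp: c_def)
  then have "(\<Sum>i<n. \<Sum>j<n. d ((g(k := y)) i) ((g(k := y)) j))
      \<le> (\<Sum>i<n. \<Sum>j<n. d (g i) (g j) + (if i = k then c j else 0) + (if j = k then c i else 0))"
    by (intro sum_mono) auto
  also have "\<dots> = (\<Sum>i<n. \<Sum>j<n. d (g i) (g j)) + 2 * real (n - 1) * d y (g k)"
    using k c_sum c_sum' by (simp add: sum.distrib)
  finally show ?thesis .
qed

lemma fermat_dist_le:
  assumes "set xs \<subseteq> S" "B \<in> S"
  shows "fermat_dist S d xs \<le> (\<Sum>i<length xs. d (xs ! i) B)"
  unfolding fermat_dist_def using assms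
  by (intro cINF_lower bdd_belowI[where m = 0]) (auto intro!: sum_nonneg nonneg subsetD[OF _ nth_mem])

lemma fermat_dist_nonneg:
  assumes "S \<noteq> {}" "set xs \<subseteq> S"
  shows "0 \<le> fermat_dist S d xs"
  unfolding fermat_dist_def using assms
  by (intro cINF_greatest) (auto intro!: sum_nonneg nonneg subsetD[OF _ nth_mem])

lemma fermat_dist_replicate:
  assumes "a \<in> S"
  shows "fermat_dist S d (replicate m a) = 0"
proof -
  have "set (replicate m a) \<subseteq> S" using assms by auto
  then show ?thesis
    using fermat_dist_le[of "replicate m a" a] fermat_dist_nonneg[of "replicate m a"] assms
    by (force simp: self_zero)
qed

lemma fermat_dist_permute:
  assumes "\<sigma> permutes {..<length xs}"
  shows "fermat_dist S d (permute_list \<sigma> xs) = fermat_dist S d xs"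
proof -
  have "(\<Sum>i<length xs. d (permute_list \<sigma> xs ! i) B) = (\<Sum>i<length xs. d (xs ! i) B)" for B
    using assms sum.permute[OF assms, of "\<lambda>i. d (xs ! i) B"] by (simp add: permute_list_nth comp_def)
  then show ?thesis unfolding fermat_dist_def by simp
qed

lemma fermat_dist_update_le:
  assumes xs: "set xs \<subseteq> S" and a: "a \<in> S" and k: "k < length xs"
  shows "fermat_dist S d xs \<le> fermat_dist S d (xs[k := a]) + d (xs ! k) a"
proof -
  have "fermat_dist S d xs - d (xs ! k) a \<le> (\<Sum>i<length xs. d (xs[k := a] ! i) B)"
    if B: "B \<in> S" for B
  proof -
    have "fermat_dist S d xs \<le> (\<Sum>i<length xs. d (xs ! i) B)"
      by (rule fermat_dist_le[OF xs B])
    also have "\<dots> \<le> (\<Sum>i<length xs. d (xs[k := a] ! i) B + (if i = k then d (xs ! k) a else 0))"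
      using xs a k B triangle[of "xs ! k" a B] by (intro sum_mono) (auto dest: subsetD[OF _ nth_mem])
    also have "\<dots> = (\<Sum>i<length xs. d (xs[k := a] ! i) B) + d (xs ! k) a"
      using k by (simp add: sum.distrib)
    finally show ?thesis by simp
  qed
  then have "fermat_dist S d xs - d (xs ! k) a \<le> fermat_dist S d (xs[k := a])"
    unfolding fermat_dist_def[of _ _ "xs[k := a]"] using a by (intro cINF_greatest) auto
  then show ?thesis by simp
qed

lemma dist_le_fermat_dist:
  assumes xs: "set xs \<subseteq> S" and i: "i < length xs" and j: "j < length xs"
  shows "d (xs ! i) (xs ! j) \<le> fermat_dist S d xs"
proof (cases "i = j")
  case True
  then show ?thesis using xs i by (auto simp: self_zero subsetD[OF _ nth_mem] intro: fermat_dist_nonneg)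
next
  case False
  have "d (xs ! i) (xs ! j) \<le> (\<Sum>l<length xs. d (xs ! l) B)" if B: "B \<in> S" for B
  proof -
    have "xs ! i \<in> S" "xs ! j \<in> S" using xs nth_mem[OF i] nth_mem[OF j] by auto
    then have "d (xs ! i) (xs ! j) \<le> (\<Sum>l\<in>{i, j}. d (xs ! l) B)"
      using False B triangle[of "xs ! i" B "xs ! j"] commute[of B "xs ! j"] by auto
    also have "\<dots> \<le> (\<Sum>l<length xs. d (xs ! l) B)"
      using i j B by (intro sum_mono2) (auto intro!: nonneg subsetD[OF xs nth_mem])
    finally show ?thesis .
  qed
  then show ?thesis
    unfolding fermat_dist_def using xs i by (intro cINF_greatest) auto
qed

lemma fermat_dist_pseudo_n_metric:
  assumes "S \<noteq> {}"
  shows "pseudo_n_metric S n (fermat_dist S d)"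
proof (rule pseudo_n_metric_if_update_bound[where d = d])
  fix xs a assume xs: "set xs \<subseteq> S" and a: "a \<in> S" and len: "2 \<le> length xs"
  have "xs ! 0 \<in> S" using len by (intro subsetD[OF xs nth_mem]) linarith
  then have "d (xs ! 0) a \<le> real (length xs - 1) * d (xs ! 0) a"
    using a len nonneg[of "xs ! 0" a] by (simp add: mult_le_cancel_right1)
  then show "fermat_dist S d xs \<le> fermat_dist S d (xs[0 := a]) + real (length xs - 1) * d (xs ! 0) a"
    using fermat_dist_update_le[OF xs a, of 0] len by linarith
qed (use assms in \<open>auto intro: fermat_dist_nonneg fermat_dist_replicate fermat_dist_permute
      dist_le_fermat_dist\<close>)

end

lemma matrix_diff_ldistrib: "(A :: 'a::ring_1^'n^'m) ** (B - C) = A ** B - A ** C"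
  by (simp add: vec_eq_iff matrix_matrix_mult_def sum_subtractf right_diff_distrib)

lemma matrix_diff_rdistrib: "((B :: 'a::ring_1^'n^'m) - C) ** A = B ** A - C ** A"
  by (simp add: vec_eq_iff matrix_matrix_mult_def sum_subtractf left_diff_distrib)

lemma orthogonal_matrix_mul_cancel:
  assumes "orthogonal_matrix Q"
  shows "X ** transpose Q ** Q = X" and "X ** Q ** transpose Q = X"
  using assms by (simp_all add: orthogonal_matrix_def flip: matrix_mul_assoc)

abbreviation orth_families :: "nat \<Rightarrow> (nat \<Rightarrow> nat \<Rightarrow> real^'m^'m) set" where
  "orth_families n \<equiv> align_families orth_matrices (**) (mat 1) n"

lemma factored_family_in_orth_families:
  assumes R: "\<And>i. i < n \<Longrightarrow> orthogonal_matrix (R i)"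
  shows "(\<lambda>i j. R i ** transpose (R j)) \<in> orth_families n"
proof -
  have "R i ** transpose (R k) ** (R k ** transpose (R j)) = R i ** transpose (R j)"
    if "k < n" for i j k
    using R[OF that] by (simp add: matrix_mul_assoc orthogonal_matrix_mul_cancel)
  moreover have "R i ** transpose (R i) = mat 1" if "i < n" for i
    using R[OF that] by (simp add: orthogonal_matrix_def)
  ultimately show ?thesis
    using R by (simp add: align_families_def orth_matrices_def orthogonal_matrix_mul)
qed

lemma identity_family_in_orth_families: "(\<lambda>i j. mat 1) \<in> orth_families n"
  by (simp add: align_families_def orth_matrices_def orthogonal_matrix_id)

lemma orth_families_nonempty: "orth_families n \<noteq> {}"
  using identity_family_in_orth_families by blast

lemma orth_families_factor:
  assumes Q: "Q \<in> orth_families n" and k: "k < n" and i: "i < n" and j: "j < n"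
  shows "Q i j = Q i k ** transpose (Q j k)"
proof -
  have orth: "orthogonal_matrix (Q j k)" and inverse: "Q j k ** Q k j = mat 1"
    and compose: "Q i k ** Q k j = Q i j"
    using Q i j k by (simp_all add: align_families_def orth_matrices_def)
  have "transpose (Q j k) = transpose (Q j k) ** Q j k ** Q k j"
    by (simp flip: matrix_mul_assoc add: inverse)
  also have "\<dots> = Q k j"
    using orth by (simp add: orthogonal_matrix_def)
  finally show ?thesis
    using compose by simp
qed

locale orth_invariant_norm =
  fixes N :: "real^'m^'m \<Rightarrow> real"
  assumes orth_inv_matrix_norm: "orth_inv_matrix_norm N"
begin

lemma N_nonneg: "0 \<le> N M"
  using orth_inv_matrix_norm by (simp add: orth_inv_matrix_norm_def)

lemma N_zero [simp]: "N 0 = 0"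
  using orth_inv_matrix_norm by (simp add: orth_inv_matrix_norm_def)

lemma N_mult_orth [simp]:
  assumes "orthogonal_matrix P"
  shows "N (P ** M) = N M" and "N (M ** P) = N M"
  using orth_inv_matrix_norm assms by (simp_all add: orth_inv_matrix_norm_def)

lemma N_triangle: "N (M + M') \<le> N M + N M'"
  using orth_inv_matrix_norm by (simp add: orth_inv_matrix_norm_def)

lemma N_minus_commute: "N (A - B) = N (B - A)"
proof -
  have "N ((-1) *\<^sub>R (A - B)) = \<bar>-1\<bar> * N (A - B)"
    using orth_inv_matrix_norm by (simp only: orth_inv_matrix_norm_def)
  then show ?thesis by simp
qed

lemma pseudometric_on_N_dist: "pseudometric_on UNIV (\<lambda>A B. N (A - B))"
proof
  show "N (A - C) \<le> N (A - B) + N (B - C)" for A B C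
    using N_triangle[of "A - B" "B - C"] by simp
qed (simp_all add: N_minus_commute)

definition align_cost :: "real^'m^'m \<Rightarrow> real^'m^'m \<Rightarrow> real^'m^'m \<Rightarrow> real" where
  "align_cost A B P = N (A ** P - P ** B)"

definition orbit_dist :: "real^'m^'m \<Rightarrow> real^'m^'m \<Rightarrow> real" where
  "orbit_dist A B = (INF P\<in>orth_matrices. align_cost A B P)"

lemma align_cost_conj:
  assumes "orthogonal_matrix P"
  shows "align_cost A B P = N (transpose P ** A ** P - B)"
proof -
  have "align_cost A B P = N (transpose P ** (A ** P - P ** B))"
    using assms by (simp add: align_cost_def)
  also have "transpose P ** (A ** P - P ** B) = transpose P ** A ** P - B"
    using assms by (simp add: matrix_diff_ldistrib orthogonal_matrix_def matrix_mul_assoc)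
  finally show ?thesis .
qed

lemma align_cost_factored:
  assumes U: "orthogonal_matrix U" and V: "orthogonal_matrix V"
  shows "align_cost A B (U ** transpose V) = N (transpose U ** A ** U - transpose V ** B ** V)"
proof -
  have "align_cost A B (U ** transpose V)
      = N (transpose U ** (A ** (U ** transpose V) - U ** transpose V ** B) ** V)"
    using U V by (simp add: align_cost_def)
  also have "transpose U ** (A ** (U ** transpose V) - U ** transpose V ** B) ** V
      = transpose U ** A ** U - transpose V ** B ** V"
    using U V by (simp add: matrix_diff_ldistrib matrix_diff_rdistrib orthogonal_matrix_mul_cancel
        orthogonal_matrix_def matrix_mul_assoc)
  finally show ?thesis .
qed

lemma align_cost_transpose:
  assumes "orthogonal_matrix P"
  shows "align_cost B A (transpose P) = align_cost A B P"
  using align_cost_factored[of "mat 1" P B A] align_cost_factored[of P "mat 1" A B] assms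
  by (simp add: orthogonal_matrix_id N_minus_commute)

lemma align_cost_mult_le:
  assumes P: "orthogonal_matrix P" and Q: "orthogonal_matrix Q"
  shows "align_cost A C (P ** Q) \<le> align_cost A B P + align_cost B C Q"
proof -
  have "A ** (P ** Q) - P ** Q ** C = (A ** P - P ** B) ** Q + P ** (B ** Q - Q ** C)"
    by (simp add: matrix_diff_ldistrib matrix_diff_rdistrib matrix_mul_assoc)
  then show ?thesis
    using N_triangle[of "(A ** P - P ** B) ** Q" "P ** (B ** Q - Q ** C)"] P Q
    by (simp add: align_cost_def)
qed

lemma orth_matrices_nonempty: "orth_matrices \<noteq> {}"
  using orthogonal_matrix_id by (auto simp: orth_matrices_def)

lemma orbit_dist_le: "orthogonal_matrix P \<Longrightarrow> orbit_dist A B \<le> align_cost A B P"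
  unfolding orbit_dist_def
  by (rule cINF_lower) (auto simp: orth_matrices_def align_cost_def intro!: bdd_belowI[where m = 0] N_nonneg)

lemma orbit_dist_nonneg: "0 \<le> orbit_dist A B"
  unfolding orbit_dist_def
  by (rule cINF_greatest[OF orth_matrices_nonempty]) (simp add: align_cost_def N_nonneg)

lemma pseudometric_on_orbit_dist: "pseudometric_on UNIV orbit_dist"
proof
  show "orbit_dist A A = 0" for A
    using orbit_dist_le[OF orthogonal_matrix_id, of A A] orbit_dist_nonneg[of A A]
    by (simp add: align_cost_def)
  have le_swap: "orbit_dist A B \<le> orbit_dist B A" for A B
    unfolding orbit_dist_def[of B A]
  proof (rule cINF_greatest[OF orth_matrices_nonempty])
    fix P :: "real^'m^'m" assume "P \<in> orth_matrices"
    then show "orbit_dist A B \<le> align_cost B A P"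
      using orbit_dist_le[of "transpose P" A B] align_cost_transpose[of P A B]
      by (simp add: orth_matrices_def)
  qed
  show "orbit_dist A B = orbit_dist B A" for A B
    using le_swap[of A B] le_swap[of B A] by simp
  show "orbit_dist A C \<le> orbit_dist A B + orbit_dist B C" for A B C
  proof -
    have bound: "orbit_dist A C \<le> align_cost A B P + align_cost B C Q"
      if "P \<in> orth_matrices" "Q \<in> orth_matrices" for P Q
      using that orbit_dist_le[OF orthogonal_matrix_mul, of P Q A C] align_cost_mult_le[of P Q A C B]
      by (simp add: orth_matrices_def)
    have "orbit_dist A C - align_cost B C Q \<le> orbit_dist A B" if Q: "Q \<in> orth_matrices" for Q
      unfolding orbit_dist_def[of A B]
    proof (rule cINF_greatest[OF orth_matrices_nonempty])
      fix P :: "real^'m^'m" assume "P \<in> orth_matrices"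
      then show "orbit_dist A C - align_cost B C Q \<le> align_cost A B P"
        using bound[OF _ Q] by fastforce
    qed
    then have "orbit_dist A C - orbit_dist A B \<le> orbit_dist B C"
      unfolding orbit_dist_def[of B C]
      by (intro cINF_greatest[OF orth_matrices_nonempty]) fastforce
    then show ?thesis by simp
  qed
qed

abbreviation galign :: "(real^'m^'m) list \<Rightarrow> real" where
  "galign \<equiv> galign_dist align_cost orth_matrices"

definition family_cost :: "(real^'m^'m) list \<Rightarrow> (nat \<Rightarrow> nat \<Rightarrow> real^'m^'m) \<Rightarrow> real" where
  "family_cost xs Q = 1/2 * (\<Sum>i<length xs. \<Sum>j<length xs. align_cost (xs ! i) (xs ! j) (Q i j))"

lemma galign_eq: "galign xs = (INF Q\<in>orth_families (length xs). family_cost xs Q)"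
  by (simp add: galign_dist_def family_cost_def)

lemma family_cost_nonneg: "0 \<le> family_cost xs Q"
  by (auto simp: family_cost_def align_cost_def intro!: sum_nonneg N_nonneg)

lemma family_cost_factored:
  assumes "\<And>i. i < length xs \<Longrightarrow> orthogonal_matrix (R i)"
    and "\<And>i j. i < length xs \<Longrightarrow> j < length xs \<Longrightarrow> Q i j = R i ** transpose (R j)"
  shows "family_cost xs Q = 1/2 * (\<Sum>i<length xs. \<Sum>j<length xs.
      N (transpose (R i) ** (xs ! i) ** R i - transpose (R j) ** (xs ! j) ** R j))"
  unfolding family_cost_def
  by (intro arg_cong[where f = "\<lambda>t. 1/2 * t"] sum.cong refl) (simp add: assms align_cost_factored)

lemma galign_le_family_cost: "Q \<in> orth_families (length xs) \<Longrightarrow> galign xs \<le> family_cost xs Q"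
  unfolding galign_eq by (rule cINF_lower) (auto intro!: bdd_belowI[where m = 0] family_cost_nonneg)

lemma galign_nonneg: "0 \<le> galign xs"
  unfolding galign_eq by (rule cINF_greatest[OF orth_families_nonempty]) (rule family_cost_nonneg)

lemma galign_replicate: "galign (replicate m a) = 0"
  using galign_le_family_cost[OF identity_family_in_orth_families, of "replicate m a"]
    galign_nonneg[of "replicate m a"]
  by (simp add: family_cost_def align_cost_def)

lemma galign_permute_le:
  assumes \<sigma>: "\<sigma> permutes {..<length xs}"
  shows "galign (permute_list \<sigma> xs) \<le> galign xs"
  unfolding galign_eq[of xs]
proof (rule cINF_greatest[OF orth_families_nonempty])
  let ?n = "length xs"
  fix Q :: "nat \<Rightarrow> nat \<Rightarrow> real^'m^'m" assume Q: "Q \<in> orth_families ?n"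
  have "(\<lambda>i j. Q (\<sigma> i) (\<sigma> j)) \<in> orth_families ?n"
    using Q permutes_in_image[OF \<sigma>] by (simp add: align_families_def)
  then have "galign (permute_list \<sigma> xs) \<le> family_cost (permute_list \<sigma> xs) (\<lambda>i j. Q (\<sigma> i) (\<sigma> j))"
    by (intro galign_le_family_cost) simp
  also have "\<dots> = 1/2 * (\<Sum>i<?n. \<Sum>j<?n. align_cost (xs ! \<sigma> i) (xs ! \<sigma> j) (Q (\<sigma> i) (\<sigma> j)))"
    using \<sigma> by (simp add: family_cost_def permute_list_nth)
  also have "\<dots> = family_cost xs Q"
  proof -
    have reindex: "(\<Sum>i<?n. f (\<sigma> i)) = (\<Sum>i<?n. f i)" for f :: "nat \<Rightarrow> real"
      using sum.permute[OF \<sigma>, of f] by (simp add: comp_def)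
    have "(\<Sum>j<?n. align_cost (xs ! \<sigma> i) (xs ! \<sigma> j) (Q (\<sigma> i) (\<sigma> j)))
        = (\<Sum>j<?n. align_cost (xs ! \<sigma> i) (xs ! j) (Q (\<sigma> i) j))" for i
      by (rule reindex)
    moreover have "(\<Sum>i<?n. \<Sum>j<?n. align_cost (xs ! \<sigma> i) (xs ! j) (Q (\<sigma> i) j))
        = (\<Sum>i<?n. \<Sum>j<?n. align_cost (xs ! i) (xs ! j) (Q i j))"
      by (rule reindex)
    ultimately show ?thesis
      by (simp add: family_cost_def)
  qed
  finally show "galign (permute_list \<sigma> xs) \<le> family_cost xs Q" .
qed

lemma galign_permute:
  assumes \<sigma>: "\<sigma> permutes {..<length xs}"
  shows "galign (permute_list \<sigma> xs) = galign xs"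
proof -
  have inv: "inv \<sigma> permutes {..<length (permute_list \<sigma> xs)}"
    using permutes_inv[OF \<sigma>] by simp
  have "permute_list (inv \<sigma>) (permute_list \<sigma> xs) = xs"
    using permute_list_compose[of "inv \<sigma>" xs \<sigma>] permutes_inv[OF \<sigma>] permutes_inv_o(1)[OF \<sigma>] by simp
  then show ?thesis
    using galign_permute_le[OF inv] galign_permute_le[OF \<sigma>] by simp
qed

lemma orbit_dist_le_galign:
  assumes i: "i < length xs" and j: "j < length xs"
  shows "orbit_dist (xs ! i) (xs ! j) \<le> galign xs"
proof (cases "i = j")
  case True
  then show ?thesis
    using pseudometric_on.self_zero[OF pseudometric_on_orbit_dist] galign_nonneg by simp
next
  case False
  let ?n = "length xs"
  show ?thesis
    unfolding galign_eq
  proof (rule cINF_greatest[OF orth_families_nonempty])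
    fix Q :: "nat \<Rightarrow> nat \<Rightarrow> real^'m^'m" assume Q: "Q \<in> orth_families ?n"
    let ?c = "\<lambda>(l, l'). align_cost (xs ! l) (xs ! l') (Q l l')"
    have "orthogonal_matrix (Q i j)" "orthogonal_matrix (Q j i)"
      using Q i j by (auto simp: align_families_def orth_matrices_def)
    then have "orbit_dist (xs ! i) (xs ! j) \<le> align_cost (xs ! i) (xs ! j) (Q i j)"
      and "orbit_dist (xs ! j) (xs ! i) \<le> align_cost (xs ! j) (xs ! i) (Q j i)"
      using orbit_dist_le by simp_all
    then have "2 * orbit_dist (xs ! i) (xs ! j) \<le> ?c (i, j) + ?c (j, i)"
      using pseudometric_on.commute[OF pseudometric_on_orbit_dist, of "xs ! j" "xs ! i"] by simp
    also have "\<dots> = (\<Sum>p\<in>{(i, j), (j, i)}. ?c p)"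
      using False by simp
    also have "\<dots> \<le> (\<Sum>p\<in>{..<?n} \<times> {..<?n}. ?c p)"
      using i j by (intro sum_mono2) (auto simp: align_cost_def N_nonneg)
    also have "\<dots> = 2 * family_cost xs Q"
      by (simp add: family_cost_def sum.cartesian_product)
    finally show "orbit_dist (xs ! i) (xs ! j) \<le> family_cost xs Q"
      by simp
  qed
qed

lemma galign_le_update_family_cost:
  assumes Q: "Q \<in> orth_families (length xs)" and k: "k < length xs" and P: "orthogonal_matrix P"
  shows "galign xs \<le> family_cost (xs[k := a]) Q + real (length xs - 1) * align_cost (xs ! k) a P"
proof -
  define n where "n = length xs"
  define R where "R i = Q i k" for i
  define R' where "R' = R(k := P)"
  define g where "g i = transpose (R i) ** (xs[k := a] ! i) ** R i" for i
  define x' where "x' = transpose P ** (xs ! k) ** P"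
  have R: "orthogonal_matrix (R i)" if "i < n" for i
    using Q that k by (simp add: R_def n_def align_families_def orth_matrices_def)
  have R': "orthogonal_matrix (R' i)" if "i < n" for i
    using R[OF that] P by (simp add: R'_def)
  have "R k = mat 1"
    using Q k by (simp add: R_def align_families_def)
  then have g_k: "g k = a"
    using k by (simp add: g_def)
  have old: "family_cost (xs[k := a]) Q = 1/2 * (\<Sum>i<n. \<Sum>j<n. N (g i - g j))"
  proof (rule family_cost_factored[THEN trans])
    show "orthogonal_matrix (R i)" if "i < length (xs[k := a])" for i
      using R that by (simp add: n_def)
    show "Q i j = R i ** transpose (R j)" if "i < length (xs[k := a])" "j < length (xs[k := a])" for i j
      using orth_families_factor[OF Q k] that by (simp add: R_def n_def)
  qed (simp add: g_def n_def)
  have conj: "transpose (R' i) ** (xs ! i) ** R' i = (g(k := x')) i" for i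
    by (simp add: R'_def g_def x'_def)
  have "galign xs \<le> family_cost xs (\<lambda>i j. R' i ** transpose (R' j))"
    using R' by (intro galign_le_family_cost factored_family_in_orth_families) (simp add: n_def)
  also have "\<dots> = 1/2 * (\<Sum>i<n. \<Sum>j<n. N ((g(k := x')) i - (g(k := x')) j))"
    unfolding n_def conj[symmetric] by (rule family_cost_factored) (use R' in \<open>simp_all add: n_def\<close>)
  also have "\<dots> \<le> 1/2 * ((\<Sum>i<n. \<Sum>j<n. N (g i - g j)) + 2 * real (n - 1) * N (x' - g k))"
    using k by (intro mult_left_mono pseudometric_on.sum_pairwise_update_le[OF pseudometric_on_N_dist])
      (simp_all add: n_def)
  also have "\<dots> = family_cost (xs[k := a]) Q + real (n - 1) * align_cost (xs ! k) a P"
    using P old by (simp add: align_cost_conj g_k x'_def algebra_simps)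
  finally show ?thesis
    by (simp add: n_def)
qed

lemma galign_update_le:
  assumes k: "k < length xs"
  shows "galign xs \<le> galign (xs[k := a]) + real (length xs - 1) * orbit_dist (xs ! k) a"
proof -
  have "galign xs - galign (xs[k := a]) \<le> real (length xs - 1) * align_cost (xs ! k) a P"
    if P: "P \<in> orth_matrices" for P
  proof -
    have "galign xs - real (length xs - 1) * align_cost (xs ! k) a P \<le> galign (xs[k := a])"
      unfolding galign_eq[of "xs[k := a]"]
    proof (rule cINF_greatest[OF orth_families_nonempty])
      fix Q :: "nat \<Rightarrow> nat \<Rightarrow> real^'m^'m" assume "Q \<in> orth_families (length (xs[k := a]))"
      then show "galign xs - real (length xs - 1) * align_cost (xs ! k) a P \<le> family_cost (xs[k := a]) Q"
        using galign_le_update_family_cost[of Q xs k P a] k P by (simp add: orth_matrices_def)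
    qed
    then show ?thesis by simp
  qed
  then have "galign xs - galign (xs[k := a]) \<le> real (length xs - 1) * orbit_dist (xs ! k) a"
    unfolding orbit_dist_def by (intro le_mult_cINF orth_matrices_nonempty) auto
  then show ?thesis by simp
qed

lemma galign_pseudo_n_metric: "pseudo_n_metric S n galign"
proof (rule pseudo_n_metric_if_update_bound[where d = orbit_dist])
  fix xs :: "(real^'m^'m) list" and a assume "2 \<le> length xs"
  then show "galign xs \<le> galign (xs[0 := a]) + real (length xs - 1) * orbit_dist (xs ! 0) a"
    by (intro galign_update_le) linarith
qed (simp_all add: galign_nonneg galign_replicate galign_permute orbit_dist_le_galign)

end

theorem theorem5:
  fixes N :: "real^'m^'m \<Rightarrow> real" and n :: nat
    and s :: "real^'m^'m \<Rightarrow> real^'m^'m \<Rightarrow> real^'m^'m \<Rightarrow> real"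
    and d :: "real^'m^'m \<Rightarrow> real^'m^'m \<Rightarrow> real"
  assumes "orth_inv_matrix_norm N"
    and "\<And>A B P. s A B P = N (A ** P - P ** B)"
    and "\<And>A B. d A B = (INF P\<in>orth_matrices. s A B P)"
  shows "pseudo_n_metric sym_matrices n (fermat_dist sym_matrices d)
       \<and> pseudo_n_metric sym_matrices n (galign_dist s orth_matrices)"
proof -
  interpret orth_invariant_norm N
    by (rule orth_invariant_norm.intro) (fact assms(1))
  have s: "s = align_cost"
    using assms(2) by (intro ext) (simp add: align_cost_def)
  have d: "d = orbit_dist"
    using assms(3) by (intro ext) (simp add: orbit_dist_def s)
  have "pseudometric_on sym_matrices orbit_dist"
    by (rule pseudometric_on.subset[OF pseudometric_on_orbit_dist]) simp
  moreover have "mat 1 \<in> sym_matrices"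
    by (simp add: sym_matrices_def transpose_mat)
  ultimately show ?thesis
    unfolding s d using pseudometric_on.fermat_dist_pseudo_n_metric galign_pseudo_n_metric by blast
qed

end
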